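(* Fix a positive integer $d$. For $n \geq 1$ let $v_n = n^d$ and let $t_{n,d}$ denote the number of subsets $S \subseteq [n]^d$ that tile $\mathbb{Z}^d$ by translations. Then, as $n \to \infty$, \[ \left(3^{\frac{1}{3}}\right)^{v_n - o(v_n)} \leq t_{n,d} \leq \left(3^{\frac{1}{3}}\right)^{v_n + o(v_n)}. \]
   Context: $[n] = \{1,\ldots,n\}$. A set $S \subseteq \mathbb{Z}^d$ tiles $\mathbb{Z}^d$ by translations if there exist $z_i \in \mathbb{Z}^d$ such that $\mathbb{Z}^d$ is the disjoint union $\dot\bigcup_i (S + z_i)$. *)

theory Defs
  imports "HOL-Analysis.Finite_Cartesian_Product" "HOL-Library.Landau_Symbols" "HOL-Library.Disjoint_Sets"
begin

definition cube :: "nat \<Rightarrow> (int ^ 'd) set" where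
  "cube n = {x. \<forall>i. x $ i \<in> {1..int n}}"

text \<open>
  Collecting the translation vectors in a set rather than an indexed family loses nothing:
  a nonempty \<open>S\<close> is not disjoint from itself, so a tiling never repeats a vector, and
  the empty set does not tile under either reading.
\<close>

definition tiles :: "(int ^ 'd) set \<Rightarrow> bool" where
  "tiles S \<longleftrightarrow> (\<exists>Z. disjoint_family_on (\<lambda>z. (\<lambda>x. x + z) ` S) Z \<and> (\<Union>z\<in>Z. (\<lambda>x. x + z) ` S) = UNIV)"

definition tile_count :: "'d::finite itself \<Rightarrow> nat \<Rightarrow> nat" where
  "tile_count _ n = card {S :: (int ^ 'd) set. S \<subseteq> cube n \<and> tiles S}"

end

theory Submission
  imports Defs "HOL-Analysis.Convex" "HOL-Real_Asymp.Real_Asymp"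
begin

text \<open>
  Lower bound: for \<open>m = n div 3\<close>, picking one of \<open>x\<close>, \<open>x + m e\<close>, \<open>x + 2 m e\<close> for each \<open>x\<close> in
  \<open>[m] \<times> [n]\<^sup>d\<^sup>-\<^sup>1\<close> gives a set of representatives of a lattice, hence a tile.

  Upper bound: if \<open>S \<oplus> T = \<int>\<^sup>d\<close>, then \<open>S\<close> meets every \<open>y - T\<close> in exactly one point. The sets
  \<open>(y - T) \<inter> [n]\<^sup>d\<close> with \<open>y\<close> in a box of side \<open>K n\<close> cover \<open>[n]\<^sup>d\<close> almost uniformly when \<open>K\<close> is large,
  so Shearer's inequality and \<open>N \<le> 3 powr (N / 3)\<close> leave at most \<open>3 powr ((1 + o(1)) n\<^sup>d / 3)\<close> sets
  \<open>S\<close> for each \<open>T\<close>. Only the part of \<open>T\<close> in a window of side \<open>O(n)\<close> matters; it has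
  \<open>O(n\<^sup>d / card S)\<close> elements, so there are few choices for it unless \<open>S\<close> is small, and there are few
  small \<open>S\<close> anyway.
\<close>

subsection \<open>Shearer's inequality\<close>

text \<open>After division by the product of all \<open>a j + b j\<close> every factor lies in
  [0, 1], so lowering the exponent from \<open>1 / c\<close> to \<open>1 / card P\<close> only
  increases both terms. The arithmetic-geometric mean inequality bounds them by averages that add up
  to 1.\<close>

lemma Hoelder_two_products:
  fixes a b :: "'a \<Rightarrow> real"
  assumes fin: "finite P" and c: "0 < c" "c \<le> card P"
    and a: "\<And>j. j \<in> P \<Longrightarrow> 0 \<le> a j" and b: "\<And>j. j \<in> P \<Longrightarrow> 0 \<le> b j"
  shows "(\<Prod>j\<in>P. a j) powr (1 / c) + (\<Prod>j\<in>P. b j) powr (1 / c) \<le> (\<Prod>j\<in>P. a j + b j) powr (1 / c)"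
\<comment> \<open>Normalisation would divide by zero here, but then a factor vanishes in both
  products on the left and \<open>0 powr _\<close> is 0.\<close>
proof (cases "\<exists>j\<in>P. a j + b j = 0")
  case True
  then obtain j where "j \<in> P" "a j + b j = 0" by blast
  with a[of j] b[of j] have "a j = 0" "b j = 0" by auto
  with \<open>j \<in> P\<close> have "(\<Prod>j\<in>P. a j) = 0" "(\<Prod>j\<in>P. b j) = 0"
    using fin by auto
  then show ?thesis by simp
next
  case False
  then have pos: "0 < a j + b j" if "j \<in> P" for j
    using a[OF that] b[OF that] that by (auto simp: order_less_le)
  have P: "P \<noteq> {}" "0 < card P" using c by auto
  have avg: "(\<Prod>j\<in>P. u j) powr (1 / c) \<le> (\<Sum>j\<in>P. u j / card P)"
    if "\<And>j. j \<in> P \<Longrightarrow> 0 \<le> u j \<and> u j \<le> 1" for u :: "'a \<Rightarrow> real"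
  proof -
    have "(\<Prod>j\<in>P. u j) powr (1 / c) \<le> (\<Prod>j\<in>P. u j) powr (1 / card P)"
      using c P that by (intro powr_mono') (auto intro!: prod_nonneg prod_le_1 simp: field_simps)
    also have "\<dots> \<le> (\<Sum>j\<in>P. u j / card P)"
      using fin P that by (intro arith_geom_mean) auto
    finally show ?thesis .
  qed
  define D where "D = (\<Prod>j\<in>P. a j + b j)"
  have D: "0 < D" unfolding D_def using pos by (intro prod_pos) auto
  have "(\<Prod>j\<in>P. a j / (a j + b j)) powr (1 / c) + (\<Prod>j\<in>P. b j / (a j + b j)) powr (1 / c)
    \<le> (\<Sum>j\<in>P. a j / (a j + b j) / card P) + (\<Sum>j\<in>P. b j / (a j + b j) / card P)"
    using a b pos by (intro add_mono avg) auto
  also have "\<dots> = (\<Sum>j\<in>P. (a j + b j) / (a j + b j) / card P)"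
    by (simp only: add_divide_distrib sum.distrib)
  also have "\<dots> = (\<Sum>j\<in>P. 1 / card P)"
    using pos by (intro sum.cong) (auto simp: order_less_le)
  also have "\<dots> = 1" using P by simp
  finally have "(\<Prod>j\<in>P. a j) powr (1 / c) / D powr (1 / c) + (\<Prod>j\<in>P. b j) powr (1 / c) / D powr (1 / c) \<le> 1"
    using D a b by (simp add: prod_dividef powr_divide prod_nonneg flip: D_def)
  then show ?thesis
    using D by (simp add: field_simps flip: D_def add_divide_distrib)
qed

text \<open>Induction on the ground set. When \<open>F\<close> is split by membership of
  \<open>x\<close>, the trace counts of the halves add up on each \<open>A y\<close> containing
  \<open>x\<close> and are merely monotone on the others; \<open>Hoelder_two_products\<close>
  recombines the halves.\<close>

lemma Shearer:
  fixes A :: "'b \<Rightarrow> 'a set"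
  assumes "finite X" "finite Y" "0 < c" "F \<subseteq> Pow X"
    and "\<And>x. x \<in> X \<Longrightarrow> c \<le> card {y \<in> Y. x \<in> A y}"
  shows "real (card F) \<le> (\<Prod>y\<in>Y. real (card ((\<lambda>S. S \<inter> A y) ` F))) powr (1 / c)"
  using assms(1,4,5)
proof (induction X arbitrary: F)
  case empty
  then have "F = {} \<or> F = {{}}" by auto
  then show ?case by auto
next
  case (insert x X)
  define t where "t G y = real (card ((\<lambda>S. S \<inter> A y) ` G))" for G y
  \<comment> \<open>Deleting \<open>x\<close> moves the second half to the smaller ground set; no
    sets merge, as all of them contain \<open>x\<close>.\<close>
  define F0 F1 where "F0 = {S \<in> F. x \<notin> S}" and "F1 = (\<lambda>S. S - {x}) ` {S \<in> F. x \<in> S}"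
  define P Q where "P = {y \<in> Y. x \<in> A y}" and "Q = {y \<in> Y. x \<notin> A y}"
  have finF: "finite F"
    using insert.prems(1) insert.hyps(1) by (meson finite_Pow_iff finite_insert finite_subset)
  have t0: "0 \<le> t G y" for G y by (simp add: t_def)
  have Y: "Y = P \<union> Q" "P \<inter> Q = {}" "finite P" "finite Q"
    using \<open>finite Y\<close> by (auto simp: P_def Q_def)
  have IH: "real (card G) \<le> (\<Prod>y\<in>Y. t G y) powr (1 / c)" if "G \<subseteq> Pow X" for G
    unfolding t_def using insert.prems(2) that by (intro insert.IH) auto
  have split: "(\<Prod>y\<in>Y. t G y) = (\<Prod>y\<in>P. t G y) * (\<Prod>y\<in>Q. t G y)" for G
    using Y by (simp add: prod.union_disjoint)
  have Fi: "F0 \<subseteq> Pow X" "F1 \<subseteq> Pow X" "finite F0" "finite F1"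
    using insert.prems(1) finF by (auto simp: F0_def F1_def)
  have "card F = card (F0 \<union> {S \<in> F. x \<in> S})"
    by (rule arg_cong[where f = card]) (auto simp: F0_def)
  also have "\<dots> = card F0 + card {S \<in> F. x \<in> S}"
    using finF by (intro card_Un_disjoint) (auto simp: F0_def)
  also have "card {S \<in> F. x \<in> S} = card F1"
    unfolding F1_def by (subst card_image) (auto simp: inj_on_def)
  finally have card: "card F = card F0 + card F1" .
  have tQ: "t F0 y \<le> t F y" "t F1 y \<le> t F y" if "y \<in> Q" for y
  proof -
    have "(\<lambda>S. S \<inter> A y) ` F0 \<subseteq> (\<lambda>S. S \<inter> A y) ` F"
      by (auto simp: F0_def)
    then show "t F0 y \<le> t F y"
      unfolding t_def using finF by (simp add: card_mono)
    have "(S - {x}) \<inter> A y = S \<inter> A y" for S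
      using that by (auto simp: Q_def)
    then have "(\<lambda>S. S \<inter> A y) ` F1 \<subseteq> (\<lambda>S. S \<inter> A y) ` F"
      by (auto simp: F1_def)
    then show "t F1 y \<le> t F y"
      unfolding t_def using finF by (simp add: card_mono)
  qed
  have tP: "t F0 y + t F1 y \<le> t F y" if "y \<in> P" for y
  proof -
    let ?T = "\<lambda>G. (\<lambda>S. S \<inter> A y) ` G"
    have xy: "x \<in> A y" using that by (auto simp: P_def)
    \<comment> \<open>Putting \<open>x\<close> back makes the traces of \<open>F1\<close> disjoint
      from those of \<open>F0\<close>, and both kinds are traces of \<open>F\<close>.\<close>
    have "insert x ((S - {x}) \<inter> A y) = S \<inter> A y" if "x \<in> S" for S
      using xy that by auto
    then have "?T F0 \<union> insert x ` ?T F1 \<subseteq> ?T F"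
      unfolding F0_def F1_def image_image by auto
    then have "card (?T F0 \<union> insert x ` ?T F1) \<le> card (?T F)"
      using finF by (intro card_mono) auto
    moreover have "card (?T F0 \<union> insert x ` ?T F1) = card (?T F0) + card (insert x ` ?T F1)"
      using Fi by (intro card_Un_disjoint) (auto simp: F0_def)
    moreover have "card (insert x ` ?T F1) = card (?T F1)"
      by (rule card_image) (auto simp: inj_on_def F1_def)
    ultimately show ?thesis by (simp add: t_def)
  qed
  define q where "q = (\<Prod>y\<in>Q. t F y) powr (1 / c)"
  have q: "(\<Prod>y\<in>Q. t F0 y) powr (1 / c) \<le> q" "(\<Prod>y\<in>Q. t F1 y) powr (1 / c) \<le> q" "0 \<le> q"
    unfolding q_def using tQ t0 by (auto intro!: powr_mono2 prod_mono prod_nonneg)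
  have "real (card F) \<le> (\<Prod>y\<in>Y. t F0 y) powr (1 / c) + (\<Prod>y\<in>Y. t F1 y) powr (1 / c)"
    unfolding card using IH[OF Fi(1)] IH[OF Fi(2)] by simp
  also have "\<dots> \<le> (\<Prod>y\<in>P. t F0 y) powr (1 / c) * q + (\<Prod>y\<in>P. t F1 y) powr (1 / c) * q"
    unfolding split using q t0 by (intro add_mono) (auto simp: powr_mult prod_nonneg intro!: mult_left_mono)
  also have "\<dots> = ((\<Prod>y\<in>P. t F0 y) powr (1 / c) + (\<Prod>y\<in>P. t F1 y) powr (1 / c)) * q"
    by (simp add: algebra_simps)
  also have "\<dots> \<le> (\<Prod>y\<in>P. t F0 y + t F1 y) powr (1 / c) * q"
  proof (intro mult_right_mono Hoelder_two_products)
    \<comment> \<open>The covering hypothesis at the new point \<open>x\<close> enters here.\<close>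
    show "c \<le> card P" using insert.prems(2)[of x] by (simp add: P_def)
  qed (use Y t0 \<open>0 < c\<close> q in simp_all)
  also have "\<dots> \<le> (\<Prod>y\<in>P. t F y) powr (1 / c) * q"
    using tP t0 q by (intro mult_right_mono powr_mono2 prod_mono prod_nonneg) (simp_all add: add_nonneg_nonneg)
  also have "\<dots> = (\<Prod>y\<in>Y. t F y) powr (1 / c)"
    unfolding split q_def using t0 by (simp add: powr_mult prod_nonneg)
  finally show ?case by (simp add: t_def)
qed

section \<open>Elementary estimates for the base of the exponential and for counting small
  subsets\<close>

lemma power3_le_3_power: "N ^ 3 \<le> (3 :: nat) ^ N"
proof -
  have "(N + 3) ^ 3 \<le> (3 :: nat) ^ (N + 3)" for N :: nat
  proof (induction N)
    case (Suc N)
    \<comment> \<open>The ratio of the cubes is largest at \<open>N = 0\<close>, where it is 64 / 27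
      < 3.\<close>
    have "(Suc N + 3) ^ 3 \<le> 3 * (N + 3) ^ 3"
      by (simp add: power3_eq_cube algebra_simps)
    also have "\<dots> \<le> 3 * 3 ^ (N + 3)" using Suc by simp
    finally show ?case by (simp only: add_Suc power_Suc)
  qed simp
  from this[of "N - 3"] have "3 \<le> N \<Longrightarrow> ?thesis" by simp
  moreover have "N = 0 \<or> N = 1 \<or> N = 2" if "\<not> 3 \<le> N" using that by auto
  ultimately show ?thesis by fastforce
qed

text \<open>The source of the base \<open>3 powr (1 / 3)\<close>: over positive integers,
  \<open>N powr (1 / N)\<close> is maximal at \<open>N = 3\<close>. Integrality matters, since over
  the reals the maximum is at e.\<close>

lemma real_le_3_powr: "real N \<le> 3 powr (real N / 3)"
proof -
  have "real (N ^ 3) \<le> real (3 ^ N)"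
    using power3_le_3_power by (simp only: of_nat_le_iff)
  also have "\<dots> = 3 powr (real N / 3 * 3)" by (simp add: powr_realpow)
  also have "\<dots> = (3 powr (real N / 3)) ^ 3" by (simp only: powr_powr[symmetric] powr_numeral powr_ge_zero)
  finally have "real N ^ 3 \<le> (3 powr (real N / 3)) ^ 3" by simp
  then show ?thesis by (simp add: power_mono_iff)
qed

lemma sum_power_le: "(\<Sum>i\<le>k. N ^ i) \<le> (N + 1) ^ k" for N k :: nat
proof (induction k)
  case (Suc k)
  have "N ^ k \<le> (N + 1) ^ k" by (intro power_mono) auto
  then have "N * N ^ k \<le> N * (N + 1) ^ k" by simp
  with Suc have "(\<Sum>i\<le>k. N ^ i) + N * N ^ k \<le> (N + 1) ^ k + N * (N + 1) ^ k" by (rule add_mono)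
  then show ?case by simp
qed simp

text \<open>Listing its elements encodes such a set by a word of length at most \<open>k\<close>
  over \<open>D\<close>. This crude bound suffices: for \<open>card D\<close> of order
  \<open>N\<close> and \<open>k\<close> of order \<open>sqrt N\<close> its logarithm is
  o(\<open>N\<close>).\<close>

lemma card_bounded_subsets_le:
  assumes "finite D" "0 \<le> k"
  shows "real (card {A. A \<subseteq> D \<and> real (card A) \<le> k}) \<le> (real (card D) + 1) powr k"
proof -
  let ?k = "nat \<lfloor>k\<rfloor>"
  have k: "real ?k \<le> k" using assms(2) by linarith
  have "{A. A \<subseteq> D \<and> real (card A) \<le> k} \<subseteq> set ` {xs. set xs \<subseteq> D \<and> length xs \<le> ?k}"
  proof safe
    fix A assume A: "A \<subseteq> D" "real (card A) \<le> k"
    then obtain xs where "set xs = A" "length xs = card A"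
      using assms(1) by (metis distinct_card finite_distinct_list finite_subset)
    moreover have "card A \<le> ?k" using A(2) by linarith
    ultimately show "A \<in> set ` {xs. set xs \<subseteq> D \<and> length xs \<le> ?k}"
      using A(1) by auto
  qed
  then have "card {A. A \<subseteq> D \<and> real (card A) \<le> k} \<le> card {xs. set xs \<subseteq> D \<and> length xs \<le> ?k}"
    using finite_lists_length_le[OF assms(1)] by (meson surj_card_le)
  also have "\<dots> \<le> (card D + 1) ^ ?k"
    by (simp only: card_lists_length_le[OF assms(1)] sum_power_le)
  finally have "real (card {A. A \<subseteq> D \<and> real (card A) \<le> k}) \<le> (real (card D) + 1) powr real ?k"
    by (simp add: powr_realpow add.commute flip: of_nat_Suc of_nat_power)
  also have "\<dots> \<le> (real (card D) + 1) powr k"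
    using k by (intro powr_mono) auto
  finally show ?thesis .
qed

subsection \<open>Boxes and tilings\<close>

lemma box_card:
  fixes A :: "'d::finite \<Rightarrow> 'a set"
  assumes "\<And>i. finite (A i)"
  shows "finite {x :: 'a ^ 'd. \<forall>i. x $ i \<in> A i}"
    and "card {x :: 'a ^ 'd. \<forall>i. x $ i \<in> A i} = (\<Prod>i\<in>UNIV. card (A i))"
proof -
  have *: "bij_betw vec_nth {x :: 'a ^ 'd. \<forall>i. x $ i \<in> A i} (PiE UNIV A)"
    by (rule bij_betw_byWitness[where f' = vec_lambda]) (auto simp: vec_eq_iff)
  have "finite (PiE UNIV A)" using assms by (intro finite_PiE) auto
  with * show "finite {x :: 'a ^ 'd. \<forall>i. x $ i \<in> A i}"
    using bij_betw_finite by blast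
  show "card {x :: 'a ^ 'd. \<forall>i. x $ i \<in> A i} = (\<Prod>i\<in>UNIV. card (A i))"
    using bij_betw_same_card[OF *] by (simp add: card_PiE)
qed

lemma int_box_card:
  shows "finite {x :: int ^ 'd::finite. \<forall>i. a \<le> x $ i \<and> x $ i \<le> b}"
    and "card {x :: int ^ 'd. \<forall>i. a \<le> x $ i \<and> x $ i \<le> b} = nat (b - a + 1) ^ CARD('d)"
  using box_card[of "\<lambda>_ :: 'd. {a..b}"] by auto

lemma cube_card:
  shows "finite (cube n :: (int ^ 'd::finite) set)"
    and "card (cube n :: (int ^ 'd) set) = n ^ CARD('d)"
  using int_box_card[where 'd = 'd, of 1 "int n"] by (auto simp: cube_def)

text \<open>Disjointness is uniqueness, and covering is existence, of a decomposition
  \<open>y = s + z\<close>; later arguments use tilings in this form.\<close>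

lemma translates_partition_iff:
  fixes S :: "(int ^ 'd) set"
  shows "disjoint_family_on (\<lambda>z. (\<lambda>x. x + z) ` S) Z \<and> (\<Union>z\<in>Z. (\<lambda>x. x + z) ` S) = UNIV
    \<longleftrightarrow> (\<forall>y. \<exists>!z. z \<in> Z \<and> y - z \<in> S)" (is "?L \<longleftrightarrow> ?R")
proof -
  have *: "y \<in> (\<lambda>x. x + z) ` S \<longleftrightarrow> y - z \<in> S" for y z :: "int ^ 'd"
    by (auto intro!: image_eqI[of _ _ "y - z"])
  have L: "?L \<longleftrightarrow> (\<forall>z\<in>Z. \<forall>w\<in>Z. z \<noteq> w \<longrightarrow> (\<forall>y. y - z \<in> S \<longrightarrow> y - w \<notin> S)) \<and> (\<forall>y. \<exists>z\<in>Z. y - z \<in> S)"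
    unfolding disjoint_family_on_def disjoint_iff set_eq_iff[of _ UNIV] UN_iff * by simp
  show ?thesis
    unfolding L
  proof (intro iffI conjI ballI allI impI)
    fix y
    assume A: "(\<forall>z\<in>Z. \<forall>w\<in>Z. z \<noteq> w \<longrightarrow> (\<forall>y. y - z \<in> S \<longrightarrow> y - w \<notin> S)) \<and> (\<forall>y. \<exists>z\<in>Z. y - z \<in> S)"
    then obtain z where z: "z \<in> Z" "y - z \<in> S" by blast
    show "\<exists>!z. z \<in> Z \<and> y - z \<in> S"
    proof (rule ex1I[of _ z])
      fix w assume "w \<in> Z \<and> y - w \<in> S"
      then show "w = z" using z conjunct1[OF A, rule_format, of w z y] by blast
    qed (simp add: z)
  next
    fix z w y
    assume R: "?R" and "z \<in> Z" "w \<in> Z" "z \<noteq> w" "y - z \<in> S"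
    then show "y - w \<notin> S" using spec[OF R, of y] by blast
  next
    fix y
    assume R: "?R"
    from spec[OF R, of y] obtain z where "z \<in> Z \<and> y - z \<in> S" by blast
    then show "\<exists>z\<in>Z. y - z \<in> S" by blast
  qed
qed

lemma tiles_iff: "tiles S \<longleftrightarrow> (\<exists>Z. \<forall>y. \<exists>!z. z \<in> Z \<and> y - z \<in> S)"
  by (simp only: tiles_def translates_partition_iff)

subsection \<open>Many tiles\<close>

text \<open>
  Choosing one point from each class of \<open>B = [m] \<times> [n]\<^sup>d\<^sup>-\<^sup>1\<close> modulo \<open>m\<close> in direction \<open>e\<close>
  gives a system of representatives of the lattice \<open>m\<int> \<times> n\<int>\<^sup>d\<^sup>-\<^sup>1\<close>.
\<close>

lemma tile_count_ge:
  assumes "0 < m" "k * m \<le> n" "0 < k"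
  shows "k ^ (m * n ^ (CARD('d) - 1)) \<le> tile_count TYPE('d::finite) n"
proof -
  \<comment> \<open>Any coordinate can serve as the distinguished direction.\<close>
  define e :: 'd where "e = undefined"
  define b where "b i = (if i = e then int m else int n)" for i
  define B where "B = {x :: int ^ 'd. \<forall>i. x $ i \<in> {1..b i}}"
  define sh where "sh j = (\<chi> i. if i = e then int m * j else 0)" for j :: int
  define R where "R h = (\<lambda>x. x + sh (int (h x))) ` B" for h :: "int ^ 'd \<Rightarrow> nat"
  have "m \<le> k * m" using assms(3) by simp
  then have mn: "0 < n" "m \<le> n" using assms(1,2) by linarith+
  then have b: "0 < b i" for i using assms by (auto simp: b_def)
  have finB: "finite B" unfolding B_def by (intro box_card) auto
  have "card B = (\<Prod>i\<in>UNIV. if i = e then m else n)"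
    unfolding B_def by (subst box_card) (auto intro!: prod.cong simp: b_def)
  also have "\<dots> = m * n ^ (CARD('d) - 1)"
    by (simp add: prod.If_cases Compl_eq_Diff_UNIV card_Diff_singleton)
  finally have cardB: "card B = m * n ^ (CARD('d) - 1)" .
  \<comment> \<open>\<open>B\<close> is a fundamental domain: its side in direction \<open>i\<close>
    equals the modulus \<open>b i\<close>, so congruent points of it coincide.\<close>
  have uniq: "x = x'" if "x \<in> B" "x' \<in> B" "\<And>i. b i dvd x $ i - x' $ i" for x x'
  proof -
    have "x $ i = x' $ i" for i
    proof -
      have "1 \<le> x $ i \<and> x $ i \<le> b i" "1 \<le> x' $ i \<and> x' $ i \<le> b i"
        using that(1,2) by (auto simp: B_def)
      then have "\<bar>x $ i - x' $ i\<bar> < b i" by linarith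
      with dvd_imp_le_int[OF _ that(3)[of i]] show ?thesis using b[of i] by force
    qed
    then show ?thesis by (simp add: vec_eq_iff)
  qed
  have sh_dvd: "b i dvd sh j $ i" for i j by (auto simp: sh_def b_def)
  have sh_inj: "sh j = sh j' \<longleftrightarrow> j = j'" for j j'
    using assms(1) by (auto simp: sh_def vec_eq_iff split: if_splits)
  have "inj_on R (PiE B (\<lambda>_. {..<k}))"
  proof (rule inj_onI)
    fix h h' assume h: "h \<in> PiE B (\<lambda>_. {..<k})" "h' \<in> PiE B (\<lambda>_. {..<k})" and eq: "R h = R h'"
    show "h = h'"
    proof (rule PiE_ext[OF h])
      fix x assume x: "x \<in> B"
      then have "x + sh (int (h x)) \<in> R h'" unfolding eq[symmetric] by (auto simp: R_def)
      then obtain x' where x': "x' \<in> B" "x + sh (int (h x)) = x' + sh (int (h' x'))"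
        by (auto simp: R_def)
      have "b i dvd x $ i - x' $ i" for i
      proof -
        have "x - x' = sh (int (h' x')) - sh (int (h x))" using x'(2) by (simp add: algebra_simps)
        then have "x $ i - x' $ i = sh (int (h' x')) $ i - sh (int (h x)) $ i"
          by (metis vector_minus_component)
        then show ?thesis using sh_dvd by (metis dvd_diff)
      qed
      with x x'(1) have "x = x'" by (rule uniq)
      with x'(2) show "h x = h' x" by (simp add: sh_inj)
    qed
  qed
  then have "card (R ` PiE B (\<lambda>_. {..<k})) = k ^ (m * n ^ (CARD('d) - 1))"
    using finB by (simp add: card_image card_PiE cardB)
  moreover have "R ` PiE B (\<lambda>_. {..<k}) \<subseteq> {S. S \<subseteq> cube n \<and> tiles S}"
  proof (clarify, intro conjI)
    fix h assume h: "h \<in> PiE B (\<lambda>_. {..<k})"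
    show "R h \<subseteq> cube n"
    proof
      fix p assume "p \<in> R h"
      then obtain x where x: "x \<in> B" "p = x + sh (int (h x))" by (auto simp: R_def)
      \<comment> \<open>The largest possible coordinate in direction \<open>e\<close> is
        \<open>m + m * (k - 1)\<close>, which \<open>k * m \<le> n\<close> keeps inside the
        cube.\<close>
      have "h x + 1 \<le> k" using h x(1) by force
      then have "m * (h x + 1) \<le> n" using assms(2) by (metis le_trans mult.commute mult_le_mono2)
      then have m1: "int m + int m * int (h x) \<le> int n"
        by (simp add: algebra_simps flip: of_nat_mult of_nat_add)
      have m2: "0 \<le> int m * int (h x)" by simp
      have xi: "1 \<le> x $ i \<and> x $ i \<le> b i" and pi: "p $ i = x $ i + sh (int (h x)) $ i" for i
        using x by (simp_all add: B_def)
      have "1 \<le> p $ i \<and> p $ i \<le> int n" for i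
        using m1 m2 xi[of i] mn unfolding pi[of i]
        by (cases "i = e") (simp_all add: sh_def b_def add_increasing2)
      then show "p \<in> cube n" by (simp add: cube_def)
    qed
    define Z where "Z = {z :: int ^ 'd. \<forall>i. b i dvd z $ i}"
    show "tiles (R h)"
      unfolding tiles_iff
    proof (intro exI[of _ Z] allI)
      fix y :: "int ^ 'd"
      \<comment> \<open>Reduction to the residues from 1 to \<open>b i\<close> instead of 0 to
        \<open>b i - 1\<close>, hence the shift by one.\<close>
      define x where "x = (\<chi> i. (y $ i - 1) mod b i + 1)"
      have "1 \<le> x $ i \<and> x $ i \<le> b i" for i
        using pos_mod_bound[OF b[of i], of "y $ i - 1"] pos_mod_sign[OF b[of i], of "y $ i - 1"]
        by (simp add: x_def)
      then have xB: "x \<in> B" by (simp add: B_def)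
      have xy: "b i dvd y $ i - x $ i" for i
        using dvd_minus_mod[of "b i" "y $ i - 1"] by (simp add: x_def algebra_simps)
      show "\<exists>!z. z \<in> Z \<and> y - z \<in> R h"
      proof (rule ex1I[of _ "y - (x + sh (int (h x)))"], intro conjI)
        show "y - (x + sh (int (h x))) \<in> Z"
          using dvd_diff[OF xy sh_dvd] by (simp add: Z_def algebra_simps)
        show "y - (y - (x + sh (int (h x)))) \<in> R h" using xB by (auto simp: R_def)
        fix z assume z: "z \<in> Z \<and> y - z \<in> R h"
        then obtain x' where x': "x' \<in> B" "y - z = x' + sh (int (h x'))" by (auto simp: R_def)
        have "b i dvd x' $ i - x $ i" for i
        proof -
          have "x' - x = (y - x) - z - sh (int (h x'))" using x'(2) by (simp add: algebra_simps)
          then have "x' $ i - x $ i = (y $ i - x $ i) - z $ i - sh (int (h x')) $ i"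
            by (metis vector_minus_component)
          moreover have "b i dvd (y $ i - x $ i) - z $ i - sh (int (h x')) $ i"
            using z by (intro dvd_diff xy sh_dvd) (simp add: Z_def)
          ultimately show ?thesis by (simp only:)
        qed
        with x'(1) xB have "x' = x" by (rule uniq)
        with x'(2) show "z = y - (x + sh (int (h x)))" by (simp add: algebra_simps)
      qed
    qed
  qed
  moreover have "finite {S :: (int ^ 'd) set. S \<subseteq> cube n \<and> tiles S}"
    by (rule finite_subset[of _ "Pow (cube n)"]) (auto simp: cube_card)
  ultimately show ?thesis
    unfolding tile_count_def by (metis (no_types, lifting) card_mono)
qed

subsection \<open>Few tiles\<close>

lemma mem_cube: "x \<in> cube n \<longleftrightarrow> (\<forall>i. 1 \<le> x $ i \<and> x $ i \<le> int n)"
  by (simp add: cube_def)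

lemma cubeD: "x \<in> cube n \<Longrightarrow> 1 \<le> x $ i" "x \<in> cube n \<Longrightarrow> x $ i \<le> int n"
  by (simp_all add: mem_cube)

text \<open>Uniqueness of the decomposition makes addition injective on
  \<open>U \<times> S\<close>.\<close>

lemma tiling_packing:
  fixes S :: "(int ^ 'd) set"
  assumes tiling: "\<forall>y. \<exists>!t. t \<in> T \<and> y - t \<in> S" and "U \<subseteq> T" "finite V"
    and "\<And>t s. t \<in> U \<Longrightarrow> s \<in> S \<Longrightarrow> t + s \<in> V"
  shows "card U * card S \<le> card V"
proof -
  have "inj_on (\<lambda>(t, s). t + s) (U \<times> S)"
  proof (rule inj_onI, clarify)
    fix t s t' s'
    assume "t \<in> U" "s \<in> S" "t' \<in> U" "s' \<in> S" and eq: "t + s = t' + s'"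
    moreover have "t + s - t = s" "t + s - t' = s'" by (simp, simp add: eq)
    ultimately have "t \<in> T" "t + s - t \<in> S" "t' \<in> T" "t + s - t' \<in> S"
      using \<open>U \<subseteq> T\<close> by auto
    then have "t = t'" using spec[OF tiling, of "t + s"] by blast
    with eq show "t = t' \<and> s = s'" by simp
  qed
  moreover have "(\<lambda>(t, s). t + s) ` (U \<times> S) \<subseteq> V" using assms(4) by auto
  ultimately show ?thesis
    using card_inj_on_le[OF _ _ \<open>finite V\<close>] by (metis card_cartesian_product)
qed

text \<open>Dually, existence of the decomposition makes the sums from \<open>U\<close> and
  \<open>S\<close> exhaust \<open>V\<close>.\<close>

lemma tiling_covering:
  fixes S :: "(int ^ 'd) set"
  assumes tiling: "\<forall>y. \<exists>!t. t \<in> T \<and> y - t \<in> S" and "finite U" "finite S"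
    and "\<And>p t. p \<in> V \<Longrightarrow> t \<in> T \<Longrightarrow> p - t \<in> S \<Longrightarrow> t \<in> U"
  shows "card V \<le> card U * card S"
proof -
  have "V \<subseteq> (\<lambda>(t, s). t + s) ` (U \<times> S)"
  proof
    fix p assume "p \<in> V"
    from spec[OF tiling, of p] obtain t where "t \<in> T" "p - t \<in> S" by blast
    then have "(t, p - t) \<in> U \<times> S" using assms(4)[OF \<open>p \<in> V\<close>] by simp
    then show "p \<in> (\<lambda>(t, s). t + s) ` (U \<times> S)"
      by (rule rev_image_eqI) simp
  qed
  then show ?thesis
    using assms(2,3) by (metis card_cartesian_product finite_cartesian_product surj_card_le)
qed

text \<open>The count is close to \<open>m ^ CARD('d) / card S\<close> for every \<open>x\<close> in
  the cube. This uniformity in \<open>x\<close> is what Shearer's inequality needs.\<close>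

lemma tiling_density:
  fixes S T :: "(int ^ 'd::finite) set"
  assumes S: "S \<subseteq> cube n" and tiling: "\<forall>y. \<exists>!t. t \<in> T \<and> y - t \<in> S" and x: "x \<in> cube n"
  shows "(m - 2 * n) ^ CARD('d) \<le> card {y \<in> cube m. y - x \<in> T} * card S"
    and "card {y \<in> cube m. y - x \<in> T} * card S \<le> (m + 2 * n) ^ CARD('d)"
proof -
  let ?U = "(\<lambda>y. y - x) ` {y \<in> cube m. y - x \<in> T}"
  have cardU: "card ?U = card {y \<in> cube m. y - x \<in> T}"
    by (rule card_image) (simp add: inj_on_def)
  have fin: "finite S" "finite ?U"
    using S finite_subset[OF _ cube_card(1)] by (auto simp: cube_card)
  \<comment> \<open>If \<open>p - t\<close> and \<open>x\<close> both lie in \<open>cube n\<close>,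
    then \<open>t + x\<close> differs from \<open>p\<close> by less than \<open>n\<close> in each
    coordinate, so this margin keeps it in \<open>cube m\<close>.\<close>
  have "card {p :: int ^ 'd. \<forall>i. int n + 1 \<le> p $ i \<and> p $ i \<le> int m - int n} \<le> card ?U * card S"
  proof (rule tiling_covering[OF tiling fin(2,1)])
    fix p t assume p: "p \<in> {p :: int ^ 'd. \<forall>i. int n + 1 \<le> p $ i \<and> p $ i \<le> int m - int n}"
      and t: "t \<in> T" "p - t \<in> S"
    have pt: "p - t \<in> cube n" using t(2) S by blast
    have "int n + 1 \<le> p $ i" "p $ i \<le> int m - int n" for i using p by simp_all
    then have "1 \<le> (t + x) $ i \<and> (t + x) $ i \<le> int m" for i
      using cubeD[OF pt, of i] cubeD[OF x, of i] by (smt (verit) vector_add_component vector_minus_component)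
    then have "t + x \<in> cube m" by (simp add: mem_cube)
    then show "t \<in> ?U" using t(1) by (intro image_eqI[of _ _ "t + x"]) auto
  qed
  then show "(m - 2 * n) ^ CARD('d) \<le> card {y \<in> cube m. y - x \<in> T} * card S"
    unfolding cardU int_box_card by (simp add: nat_diff_distrib' algebra_simps nat_mult_distrib)
  \<comment> \<open>The sums lie between \<open>2 - n\<close> and \<open>m + n - 1\<close>; the
    slack gives the box side exactly \<open>m + 2 * n\<close>.\<close>
  have "card ?U * card S \<le> card {p :: int ^ 'd. \<forall>i. 1 - int n \<le> p $ i \<and> p $ i \<le> int m + int n}"
  proof (rule tiling_packing[OF tiling _ int_box_card(1)])
    fix t s assume t: "t \<in> ?U" and s: "s \<in> S"
    then obtain y where y: "y \<in> cube m" "t = y - x" by auto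
    have sn: "s \<in> cube n" using s S by blast
    have "1 - int n \<le> (t + s) $ i \<and> (t + s) $ i \<le> int m + int n" for i
      using cubeD[OF sn, of i] cubeD[OF y(1), of i] cubeD[OF x, of i] by (simp add: y(2))
    then show "t + s \<in> {p. \<forall>i. 1 - int n \<le> p $ i \<and> p $ i \<le> int m + int n}" by simp
  qed auto
  moreover have "nat (int m + int n - (1 - int n) + 1) = m + 2 * n" by linarith
  ultimately show "card {y \<in> cube m. y - x \<in> T} * card S \<le> (m + 2 * n) ^ CARD('d)"
    unfolding cardU int_box_card by simp
qed

text \<open>
  For \<open>y \<in> [m]\<^sup>d\<close> the set \<open>A y = (y - T) \<inter> [n]\<^sup>d\<close> meets every admissible \<open>S\<close> in a single point,
  so it has at most \<open>card (A y) \<le> 3 powr (card (A y) / 3)\<close> traces, and by the density bounds the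
  sets \<open>A y\<close> cover \<open>[n]\<^sup>d\<close> almost uniformly.
\<close>

lemma card_tiles_sharing_translations_le:
  fixes S\<^sub>0 T :: "(int ^ 'd::finite) set"
  assumes S\<^sub>0: "S\<^sub>0 \<subseteq> cube n" and tiling: "\<forall>y. \<exists>!t. t \<in> T \<and> y - t \<in> S\<^sub>0" and mn: "2 * n < m"
    and F: "\<And>S. S \<in> F \<Longrightarrow> S \<subseteq> cube n"
      "\<And>S y. S \<in> F \<Longrightarrow> y \<in> cube m \<Longrightarrow> \<exists>!t. t \<in> T \<and> y - t \<in> S"
  shows "real (card F) \<le> 3 powr (real (n ^ CARD('d)) / 3 * ((real m + 2 * real n) / (real m - 2 * real n)) ^ CARD('d))"
proof -
  let ?d = "CARD('d)"
  define a where "a = card S\<^sub>0"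
  define N where "N = real (n ^ ?d)"
  \<comment> \<open>Bounds for the number of \<open>y\<close> in \<open>cube m\<close> whose
    \<open>A y\<close> contains a given point. These numbers are integers, so the lower bound may be
    rounded up to \<open>c\<close>.\<close>
  define L H where "L = (real m - 2 * real n) ^ ?d / a" and "H = (real m + 2 * real n) ^ ?d / a"
  define c where "c = nat \<lceil>L\<rceil>"
  define A where "A y = {x \<in> cube n. y - x \<in> T}" for y
  have "S\<^sub>0 \<noteq> {}" using spec[OF tiling, of 0] by blast
  then have a: "0 < a"
    unfolding a_def using S\<^sub>0 finite_subset[OF _ cube_card(1)] by (metis card_gt_0_iff)
  have L: "0 < L" using mn a by (simp add: L_def)
  then have c: "0 < c" "L \<le> real c" unfolding c_def by linarith+
  have dens: "L \<le> real (card {y \<in> cube m. y - x \<in> T})" "real (card {y \<in> cube m. y - x \<in> T}) \<le> H"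
    if "x \<in> cube n" for x
  proof -
    note D = tiling_density[OF S\<^sub>0 tiling that, of m, folded a_def]
    have "real ((m - 2 * n) ^ ?d) \<le> real (card {y \<in> cube m. y - x \<in> T} * a)"
      "real (card {y \<in> cube m. y - x \<in> T} * a) \<le> real ((m + 2 * n) ^ ?d)"
      using D by (simp_all only: of_nat_le_iff)
    then show "L \<le> real (card {y \<in> cube m. y - x \<in> T})" "real (card {y \<in> cube m. y - x \<in> T}) \<le> H"
      using a mn by (simp_all add: L_def H_def pos_divide_le_eq pos_le_divide_eq of_nat_diff)
  qed
  \<comment> \<open>Double counting of the pairs with \<open>x \<in> A y\<close>.\<close>
  have "(\<Sum>y\<in>cube m. card (A y)) = (\<Sum>x\<in>cube n. card {y \<in> cube m. y - x \<in> T})"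
    unfolding A_def by (rule sum_multicount_gen) (auto simp: cube_card)
  then have "(\<Sum>y\<in>cube m. real (card (A y))) = (\<Sum>x\<in>cube n. real (card {y \<in> cube m. y - x \<in> T}))"
    by (simp only: of_nat_sum[symmetric])
  also have "\<dots> \<le> real (card (cube n :: (int ^ 'd) set)) * H"
    using dens(2) by (rule sum_bounded_above)
  finally have sumA: "(\<Sum>y\<in>cube m. real (card (A y))) \<le> N * H"
    by (simp add: cube_card N_def)
  have trace: "real (card ((\<lambda>S. S \<inter> A y) ` F)) \<le> 3 powr (real (card (A y)) / 3)" if y: "y \<in> cube m" for y
  proof -
    have finA: "finite (A y)" by (simp add: A_def cube_card)
    have "(\<lambda>S. S \<inter> A y) ` F \<subseteq> (\<lambda>x. {x}) ` A y"
    proof clarify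
      fix S assume "S \<in> F"
      from F(2)[OF this y] obtain t where t: "t \<in> T \<and> y - t \<in> S"
        and uniq: "\<forall>t'. t' \<in> T \<and> y - t' \<in> S \<longrightarrow> t' = t" by (rule ex1E)
      have eq: "x = y - t" if "x \<in> S \<inter> A y" for x
        using spec[OF uniq, of "y - x"] that by (simp add: A_def algebra_simps)
      have "y - t \<in> cube n" using t F(1)[OF \<open>S \<in> F\<close>] by blast
      with t have "y - t \<in> S \<inter> A y" by (simp add: A_def)
      with eq have "S \<inter> A y = {y - t}" by blast
      then show "S \<inter> A y \<in> (\<lambda>x. {x}) ` A y" by blast
    qed
    then have "card ((\<lambda>S. S \<inter> A y) ` F) \<le> card (A y)"
      using finA by (metis surj_card_le)
    then show ?thesis using real_le_3_powr[of "card (A y)"] by simp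
  qed
  have "real (card F) \<le> (\<Prod>y\<in>cube m. real (card ((\<lambda>S. S \<inter> A y) ` F))) powr (1 / c)"
  proof (rule Shearer[OF _ _ c(1)])
    fix x :: "int ^ 'd" assume x: "x \<in> cube n"
    have "c \<le> card {y \<in> cube m. y - x \<in> T}" using dens(1)[OF x] by (simp add: c_def nat_le_iff ceiling_le_iff)
    then show "c \<le> card {y \<in> cube m. x \<in> A y}" using x by (simp add: A_def)
  qed (use F(1) in \<open>auto simp: cube_card\<close>)
  also have "\<dots> \<le> (\<Prod>y\<in>cube m. 3 powr (real (card (A y)) / 3)) powr (1 / c)"
    using trace by (intro powr_mono2 prod_mono prod_nonneg) auto
  also have "\<dots> = (3 powr (\<Sum>y\<in>cube m. real (card (A y)) / 3)) powr (1 / c)"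
    by (subst powr_sum) (auto simp: cube_card)
  also have "\<dots> = 3 powr ((\<Sum>y\<in>cube m. real (card (A y))) / 3 / c)"
    by (simp add: powr_powr sum_divide_distrib)
  also have "\<dots> \<le> 3 powr (N * H / 3 / L)"
    using sumA L c by (intro powr_mono frac_le divide_right_mono) (auto intro: order_trans[OF sum_nonneg sumA])
  \<comment> \<open>The tile size \<open>a\<close> cancels, so the bound is the same for all
    densities of \<open>T\<close>.\<close>
  also have "N * H / 3 / L = N / 3 * ((real m + 2 * real n) / (real m - 2 * real n)) ^ ?d"
    using a by (simp add: H_def L_def power_divide)
  finally show ?thesis by (simp add: N_def)
qed

text \<open>The number of elements of \<open>S\<close> is compared with \<open>sqrt N\<close>: any threshold between \<open>log N\<close> and \<open>N / log N\<close> works.\<close>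

lemma tile_count_le:
  assumes n: "0 < n" and K: "2 < K"
  defines "N \<equiv> real (n ^ CARD('d::finite))" and "C \<equiv> real ((K + 2) ^ CARD('d))"
  shows "real (tile_count TYPE('d) n)
    \<le> 2 * (C * N + 1) powr (C * sqrt N) * 3 powr (N / 3 * ((real K + 2) / (real K - 2)) ^ CARD('d))"
proof -
  let ?d = "CARD('d)"
  define m where "m = K * n"
  \<comment> \<open>Exactly the range of differences \<open>y - s\<close> with \<open>y\<close> in
    \<open>cube m\<close> and \<open>s\<close> in \<open>cube n\<close>: translations outside it are
    invisible from \<open>cube m\<close>.\<close>
  define W where "W = {t :: int ^ 'd. \<forall>i. 1 - int n \<le> t $ i \<and> t $ i \<le> int m - 1}"
  define E where "E = 3 powr (N / 3 * ((real K + 2) / (real K - 2)) ^ ?d)"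
  define P where "P = (C * N + 1) powr (C * sqrt N)"
  define small where "small = {S :: (int ^ 'd) set. S \<subseteq> cube n \<and> real (card S) \<le> sqrt N}"
  define \<T> where "\<T> = {T'. T' \<subseteq> W \<and> real (card T') \<le> C * sqrt N \<and>
    (\<exists>S T. S \<subseteq> cube n \<and> (\<forall>y. \<exists>!t. t \<in> T \<and> y - t \<in> S) \<and> T' = T \<inter> W)}"
  define F where "F T' = {S :: (int ^ 'd) set. S \<subseteq> cube n \<and> (\<forall>y\<in>cube m. \<exists>!t. t \<in> T' \<and> y - t \<in> S)}" for T'
  have N: "1 \<le> N" using n by (simp add: N_def)
  have C: "1 \<le> C" by (simp add: C_def)
  have mn: "2 * n < m" using n K by (simp add: m_def)
  have K': "0 < real K - 2" using K by simp
  have finW: "finite W" unfolding W_def by (rule int_box_card)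
  have "card W = (m + n - 1) ^ ?d"
    unfolding W_def int_box_card using n by (intro arg_cong[where f = "\<lambda>k. k ^ ?d"]) linarith
  also have "\<dots> \<le> ((K + 2) * n) ^ ?d"
    by (intro power_mono) (auto simp: m_def)
  finally have "card W \<le> ((K + 2) * n) ^ ?d" .
  then have "real (card W) \<le> real (((K + 2) * n) ^ ?d)" by (simp only: of_nat_le_iff)
  also have CN: "real (((K + 2) * n) ^ ?d) = C * N"
    by (simp only: C_def N_def power_mult_distrib of_nat_mult)
  finally have cardW: "real (card W) \<le> C * N" .
  have window: "t \<in> W" if "S \<subseteq> cube n" "y \<in> cube m" "y - t \<in> S" for S y t
  proof -
    have yt: "y - t \<in> cube n" using that by blast
    have "1 - int n \<le> t $ i \<and> t $ i \<le> int m - 1" for i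
      using cubeD[OF yt, of i] cubeD[OF that(2), of i] by simp
    then show ?thesis by (simp add: W_def)
  qed
  have finF: "finite (F T')" for T'
    by (rule finite_subset[of _ "Pow (cube n)"]) (auto simp: F_def cube_card)
  have fin\<T>: "finite \<T>"
    by (rule finite_subset[of _ "Pow W"]) (auto simp: \<T>_def finW)
  have cardF: "real (card (F T')) \<le> E" if "T' \<in> \<T>" for T'
  proof -
    \<comment> \<open>The density bounds need a full translation set, so some tiling with window
      trace \<open>T'\<close> is chosen; members of \<open>F T'\<close> see only that trace.\<close>
    from that obtain S T where S: "S \<subseteq> cube n" and T: "\<forall>y. \<exists>!t. t \<in> T \<and> y - t \<in> S" and T': "T' = T \<inter> W"
      by (auto simp: \<T>_def)
    have "real (card (F T')) \<le> 3 powr (N / 3 * ((real m + 2 * real n) / (real m - 2 * real n)) ^ ?d)"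
      unfolding N_def
    proof (rule card_tiles_sharing_translations_le[OF S T mn])
      fix S' and y :: "int ^ 'd" assume S': "S' \<in> F T'" and y: "y \<in> cube m"
      then have "\<exists>!t. t \<in> T \<inter> W \<and> y - t \<in> S'" by (simp add: F_def T')
      moreover have "t \<in> T \<inter> W \<and> y - t \<in> S' \<longleftrightarrow> t \<in> T \<and> y - t \<in> S'" for t
        using window[of S' y t] S' y by (auto simp: F_def)
      ultimately show "\<exists>!t. t \<in> T \<and> y - t \<in> S'" by simp
    qed (simp add: F_def)
    also have "(real m + 2 * real n) / (real m - 2 * real n) = (real n * (real K + 2)) / (real n * (real K - 2))"
      by (simp add: m_def algebra_simps)
    also have "\<dots> = (real K + 2) / (real K - 2)" using n by simp
    finally show ?thesis by (simp add: E_def)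
  qed
  have "{S :: (int ^ 'd) set. S \<subseteq> cube n \<and> tiles S} \<subseteq> small \<union> (\<Union>T'\<in>\<T>. F T')"
  proof clarify
    fix S :: "(int ^ 'd) set"
    assume S: "S \<subseteq> cube n" "tiles S" and "S \<notin> (\<Union>T'\<in>\<T>. F T')"
    from S(2) obtain T where T: "\<forall>y. \<exists>!t. t \<in> T \<and> y - t \<in> S" by (auto simp: tiles_iff)
    have "S \<in> F (T \<inter> W)"
    proof -
      have "\<exists>!t. t \<in> T \<inter> W \<and> y - t \<in> S" if y: "y \<in> cube m" for y
      proof -
        have "t \<in> T \<inter> W \<and> y - t \<in> S \<longleftrightarrow> t \<in> T \<and> y - t \<in> S" for t
          using window[OF S(1) y] by auto
        then show ?thesis using spec[OF T, of y] by simp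
      qed
      then show ?thesis using S(1) by (simp add: F_def)
    qed
    with \<open>S \<notin> _\<close> have "T \<inter> W \<notin> \<T>" by blast
    moreover have "T \<inter> W \<in> \<T>" if "real (card (T \<inter> W)) \<le> C * sqrt N"
      unfolding \<T>_def by (intro CollectI conjI exI[of _ S] exI[of _ T] that S(1) T refl Int_lower2)
    \<comment> \<open>Many translations in the window force a small tile, since the disjoint
      translates lie in a box of \<open>C * N\<close> points.\<close>
    ultimately have big: "C * sqrt N < real (card (T \<inter> W))" by force
    have "card (T \<inter> W) * card S \<le> card {p :: int ^ 'd. \<forall>i. 1 - int n \<le> p $ i \<and> p $ i \<le> int m + int n}"
    proof (rule tiling_packing[OF T _ int_box_card(1)])
      fix t s assume t: "t \<in> T \<inter> W" and s: "s \<in> S"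
      have sn: "s \<in> cube n" using s S by blast
      have "1 - int n \<le> t $ i" "t $ i \<le> int m - 1" for i using t by (simp_all add: W_def)
      then have "1 - int n \<le> (t + s) $ i \<and> (t + s) $ i \<le> int m + int n" for i
        using cubeD[OF sn, of i] by (smt (verit) vector_add_component)
      then show "t + s \<in> {p. \<forall>i. 1 - int n \<le> p $ i \<and> p $ i \<le> int m + int n}" by simp
    qed auto
    also have "\<dots> = ((K + 2) * n) ^ ?d"
    proof -
      have "int m + int n - (1 - int n) + 1 = int ((K + 2) * n)" by (simp add: m_def algebra_simps)
      then show ?thesis by (simp only: int_box_card nat_int)
    qed
    finally have "real (card (T \<inter> W) * card S) \<le> real (((K + 2) * n) ^ ?d)" by (simp only: of_nat_le_iff)
    then have le: "real (card (T \<inter> W)) * real (card S) \<le> C * N"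
      by (simp only: CN of_nat_mult)
    have "C * sqrt N * real (card S) \<le> real (card (T \<inter> W)) * real (card S)"
      using big by (intro mult_right_mono) auto
    also note le
    also have "C * N = C * sqrt N * sqrt N" using N by simp
    finally have "real (card S) \<le> sqrt N"
      using C N by (simp add: mult_le_cancel_left_pos)
    then show "S \<in> small" using S(1) by (simp add: small_def)
  qed
  moreover have finsmall: "finite small"
    by (rule finite_subset[of _ "Pow (cube n)"]) (auto simp: small_def cube_card)
  ultimately have "tile_count TYPE('d) n \<le> card (small \<union> (\<Union>T'\<in>\<T>. F T'))"
    unfolding tile_count_def using finF fin\<T> by (intro card_mono) auto
  also have "\<dots> \<le> card small + card (\<Union>T'\<in>\<T>. F T')" by (rule card_Un_le)
  also have "\<dots> \<le> card small + (\<Sum>T'\<in>\<T>. card (F T'))"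
    using card_UN_le[OF fin\<T>] by simp
  finally have count: "tile_count TYPE('d) n \<le> card small + (\<Sum>T'\<in>\<T>. card (F T'))" .
  have "real (tile_count TYPE('d) n) \<le> real (card small) + (\<Sum>T'\<in>\<T>. real (card (F T')))"
    using count by (simp only: of_nat_le_iff flip: of_nat_sum of_nat_add)
  moreover have "(\<Sum>T'\<in>\<T>. real (card (F T'))) \<le> real (card \<T>) * E"
    using cardF by (rule sum_bounded_above)
  moreover have "real (card \<T>) * E \<le> P * E"
  proof (rule mult_right_mono)
    have "card \<T> \<le> card {T'. T' \<subseteq> W \<and> real (card T') \<le> C * sqrt N}"
    proof (rule card_mono)
      show "finite {T'. T' \<subseteq> W \<and> real (card T') \<le> C * sqrt N}"
        by (rule finite_subset[of _ "Pow W"]) (use finW in auto)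
      show "\<T> \<subseteq> {T'. T' \<subseteq> W \<and> real (card T') \<le> C * sqrt N}"
        unfolding \<T>_def by blast
    qed
    then have "real (card \<T>) \<le> (real (card W) + 1) powr (C * sqrt N)"
      using card_bounded_subsets_le[OF finW, of "C * sqrt N"] C N by simp
    also have "\<dots> \<le> P" unfolding P_def using cardW C N by (intro powr_mono2) auto
    finally show "real (card \<T>) \<le> P" .
  qed (simp add: E_def)
  \<comment> \<open>Small tiles get the same bound as the rest, whence the factor 2;
    \<open>E\<close> is at least 1 because its exponent is nonnegative.\<close>
  moreover have "real (card small) \<le> P * E"
  proof -
    have "1 * N \<le> C * N" "1 * sqrt N \<le> C * sqrt N" using C N by (intro mult_right_mono; simp)+
    then have le: "N \<le> C * N" "sqrt N \<le> C * sqrt N" by simp_all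
    have "real (card small) \<le> (N + 1) powr sqrt N"
      using card_bounded_subsets_le[OF cube_card(1)[where 'd = 'd], of "sqrt N" n, unfolded cube_card(2), folded small_def N_def] N
      by simp
    also have "\<dots> \<le> (C * N + 1) powr sqrt N" using le N by (intro powr_mono2) auto
    also have "\<dots> \<le> P" unfolding P_def using le N by (intro powr_mono) auto
    also have "\<dots> = P * 1" by simp
    also have "\<dots> \<le> P * E"
      unfolding E_def using N K' by (intro mult_left_mono ge_one_powr_ge_zero) (auto simp: P_def)
    finally show ?thesis .
  qed
  ultimately have "real (tile_count TYPE('d) n) \<le> 2 * P * E" by linarith
  then show ?thesis by (simp only: P_def E_def)
qed

subsection \<open>Asymptotics\<close>

text \<open>Positivity, from the full cube (\<open>k = 1\<close>), keeps later logarithms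
  meaningful. The main bound takes \<open>k = 3\<close>, and rounding \<open>n\<close> to a multiple
  of 3 costs at most \<open>3 * n ^ (CARD('d) - 1)\<close> in the exponent.\<close>

lemma tile_count_lower:
  assumes n: "0 < n"
  shows "0 < tile_count TYPE('d::finite) n"
    and "(3 powr (1 / 3)) powr (real (n ^ CARD('d)) - 3 * real (n ^ (CARD('d) - 1))) \<le> real (tile_count TYPE('d) n)"
proof -
  define q where "q = n ^ (CARD('d) - 1)"
  have nd: "n ^ CARD('d) = n * q"
    unfolding q_def by (simp flip: power_Suc)
  have "1 \<le> tile_count TYPE('d) n"
    using tile_count_ge[where 'd = 'd, of n 1 n] n by simp
  then show pos: "0 < tile_count TYPE('d) n" by simp
  have "3 powr (real (n div 3 * q)) \<le> real (tile_count TYPE('d) n)"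
  proof (cases "n div 3 = 0")
    case True
    with pos show ?thesis by simp
  next
    case False
    then have "3 ^ (n div 3 * q) \<le> tile_count TYPE('d) n"
      unfolding q_def by (intro tile_count_ge) auto
    then have "real (3 ^ (n div 3 * q)) \<le> real (tile_count TYPE('d) n)"
      by (simp only: of_nat_le_iff)
    then show ?thesis by (subst powr_realpow) simp_all
  qed
  moreover have "(3 powr (1 / 3)) powr (real (n ^ CARD('d)) - 3 * real q) \<le> 3 powr (real (n div 3 * q))"
  proof -
    have "real n - 3 \<le> 3 * real (n div 3)" by linarith
    then have "(real n - 3) * real q \<le> 3 * real (n div 3) * real q" by (rule mult_right_mono) simp
    then have "1 / 3 * (real (n * q) - 3 * real q) \<le> real (n div 3 * q)"
      by (simp add: algebra_simps)
    then show ?thesis unfolding nd powr_powr by (intro powr_mono) simp_all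
  qed
  ultimately show "(3 powr (1 / 3)) powr (real (n ^ CARD('d)) - 3 * real (n ^ (CARD('d) - 1))) \<le> real (tile_count TYPE('d) n)"
    unfolding q_def by linarith
qed

text \<open>The excess of the exponent to base \<open>3 powr (1 / 3)\<close>, clipped at 0 so that
  only an upper bound is at stake. Given the tolerance, \<open>K\<close> is fixed first and
  \<open>n\<close> grows afterwards.\<close>

lemma log_tile_count_excess:
  fixes v :: "nat \<Rightarrow> real"
  defines "v \<equiv> \<lambda>n. real (n ^ CARD('d::finite))"
  shows "(\<lambda>n. max 0 (3 * log 3 (real (tile_count TYPE('d) n)) - v n)) \<in> o(v)"
proof (rule landau_o.smallI)
  fix \<epsilon> :: real assume \<epsilon>: "0 < \<epsilon>"
  have "(\<lambda>K::nat. (real K + 2) / (real K - 2)) \<longlonglongrightarrow> 1" by real_asymp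
  then have "(\<lambda>K::nat. ((real K + 2) / (real K - 2)) ^ CARD('d)) \<longlonglongrightarrow> 1 ^ CARD('d)"
    by (rule tendsto_power)
  then have "\<forall>\<^sub>F K in sequentially. ((real K + 2) / (real K - 2)) ^ CARD('d) < 1 + \<epsilon> / 2"
    by (rule order_tendstoD(2)) (use \<epsilon> in simp)
  then obtain K where K: "2 < K" and \<rho>: "((real K + 2) / (real K - 2)) ^ CARD('d) < 1 + \<epsilon> / 2"
    using eventually_happens[OF eventually_conj[OF eventually_gt_at_top[of 2]]]
    by (metis (no_types, lifting) trivial_limit_sequentially)
  define C where "C = real ((K + 2) ^ CARD('d))"
  have C: "0 < C" by (simp add: C_def)
  \<comment> \<open>Up to the change of base, the logarithm of the subexponential factor in
    \<open>tile_count_le\<close>.\<close>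
  define h where "h x = 3 / ln 3 * (ln 2 + C * sqrt x * ln (C * x + 1))" for x :: real
  have "((\<lambda>x. h x / x) \<longlongrightarrow> 0) at_top"
    unfolding h_def using C by real_asymp
  then have "\<forall>\<^sub>F x in at_top. h x / x < \<epsilon> / 2"
    by (rule order_tendstoD(2)) (use \<epsilon> in simp)
  moreover have "filterlim v at_top sequentially"
    unfolding v_def of_nat_power
    by (intro filterlim_pow_at_top filterlim_real_sequentially) simp
  ultimately have "\<forall>\<^sub>F n in sequentially. h (v n) / v n < \<epsilon> / 2"
    by (rule eventually_compose_filterlim)
  then show "\<forall>\<^sub>F n in sequentially. norm (max 0 (3 * log 3 (real (tile_count TYPE('d) n)) - v n)) \<le> \<epsilon> * norm (v n)"
    using eventually_gt_at_top[of 0]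
  proof eventually_elim
    case (elim n)
    define t where "t = real (tile_count TYPE('d) n)"
    define r where "r = ((real K + 2) / (real K - 2)) ^ CARD('d)"
    have t: "0 < t" using tile_count_lower(1)[OF elim(2)] by (simp add: t_def)
    have v: "0 < v n" using elim(2) by (simp add: v_def)
    have X: "0 < C * v n + 1" using C v by (simp add: add_pos_pos)
    have "t \<le> 2 * (C * v n + 1) powr (C * sqrt (v n)) * 3 powr (v n / 3 * r)"
      using tile_count_le[where 'd = 'd, OF elim(2) K] by (simp only: t_def v_def r_def C_def)
    then have "ln t \<le> ln (2 * (C * v n + 1) powr (C * sqrt (v n)) * 3 powr (v n / 3 * r))"
      using t by (intro ln_mono) simp_all
    also have "\<dots> = ln 2 + C * sqrt (v n) * ln (C * v n + 1) + v n / 3 * r * ln 3"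
      using X by (simp add: ln_mult ln_powr)
    finally have "ln t * (3 / ln 3) \<le> (ln 2 + C * sqrt (v n) * ln (C * v n + 1) + v n / 3 * r * ln 3) * (3 / ln 3)"
      by (rule mult_right_mono) simp
    also have "\<dots> = h (v n) + v n * r"
      unfolding h_def by (simp add: field_simps)
    finally have "3 * log 3 t \<le> h (v n) + v n * r" by (simp add: log_def mult.commute)
    also have "v n * r \<le> v n * (1 + \<epsilon> / 2)"
      using \<rho> v by (intro mult_left_mono) (simp_all add: r_def)
    also have "h (v n) \<le> \<epsilon> / 2 * v n"
      using elim(1) v by (simp add: pos_divide_less_eq)
    finally have "3 * log 3 t - v n \<le> \<epsilon> * v n" by (simp add: algebra_simps)
    then show ?case using v \<epsilon> by (simp add: t_def)
  qed
qed

theorem theorem1: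
  fixes v :: "nat \<Rightarrow> real"
  defines "v \<equiv> \<lambda>n. real (n ^ CARD('d::finite))"
  shows "\<exists>f\<in>o(v). \<exists>g\<in>o(v). \<forall>n\<ge>1.
    (3 powr (1 / 3)) powr (v n - f n) \<le> real (tile_count TYPE('d) n) \<and>
    real (tile_count TYPE('d) n) \<le> (3 powr (1 / 3)) powr (v n + g n)"
proof (intro bexI conjI allI impI)
  let ?f = "\<lambda>n. 3 * real (n ^ (CARD('d) - 1))"
  \<comment> \<open>Taking the excess itself makes the upper bound hold for every \<open>n\<close>;
    the content is that it is o(\<open>v\<close>).\<close>
  let ?g = "\<lambda>n. max 0 (3 * log 3 (real (tile_count TYPE('d) n)) - v n)"
  show "?g \<in> o(v)" unfolding v_def by (rule log_tile_count_excess)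
  have "(\<lambda>n. 3) \<in> o(\<lambda>n. real n)" by real_asymp
  then have "?f \<in> o(\<lambda>n. real n * real (n ^ (CARD('d) - 1)))"
    by (rule landau_o.small.mult_right)
  also have "(\<lambda>n. real n * real (n ^ (CARD('d) - 1))) = v"
    by (simp add: v_def flip: power_Suc)
  finally show "?f \<in> o(v)" .
  fix n :: nat assume "1 \<le> n"
  then have n: "0 < n" by simp
  show "(3 powr (1 / 3)) powr (v n - ?f n) \<le> real (tile_count TYPE('d) n)"
    unfolding v_def by (rule tile_count_lower(2)[OF n])
  have "log 3 (real (tile_count TYPE('d) n)) \<le> 1 / 3 * (v n + ?g n)" by simp
  then have "real (tile_count TYPE('d) n) \<le> 3 powr (1 / 3 * (v n + ?g n))"
    using tile_count_lower(1)[where 'd = 'd, OF n] by (subst (asm) log_le_iff) simp_all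
  then show "real (tile_count TYPE('d) n) \<le> (3 powr (1 / 3)) powr (v n + ?g n)"
    by (simp only: powr_powr)
qed

end
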